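(* Let $L,\ell,m,N\ge1$ be integers with $M:=L-\ell$, $m\le M-1$, $N\le L$, and let $\mathcal H_{\rm frag}=\mathrm{span}(e_1,\dots,e_\ell)\subset\mathbb{R}^L$. Any $\gamma\in\Gamma_{\rm MS}$ can be uniquely decomposed as $$\gamma=\sum_{i=1}^sn_iP_i,\qquad 1\le s\le L,\qquad 0<n_1<n_2<\cdots<n_s\le1,\qquad \sum_{i=1}^sn_im_i=N,$$ where, for $1\le i,j\le s$, $P_i\in\mathbb{R}^{L\times L}_{\rm sym}$ is an orthogonal projector of rank $m_i\ge1$ and $P_iP_j=\delta_{ij}P_i$. The linear space $$\mathcal X:=\mathcal H_{\rm frag}+\big(P_1\mathcal H_{\rm frag}\oplus\cdots\oplus P_s\mathcal H_{\rm frag}\big)$$ is the smallest $\gamma$-invariant subspace of $\mathbb{R}^L$ containing $\mathcal H_{\rm frag}$. Consequently, full disentanglement can be achieved (for $\gamma$, with bath dimension $m$) if and only if $m\ge\dim(\mathcal X)-\ell$.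
   Context: $(e_1,\dots,e_L)$ is the canonical basis of $\mathbb{R}^L$ and $\Pi_{\rm frag}$ is the orthogonal projector onto $\mathcal H_{\rm frag}$. $\Gamma_{\rm MS}:=\{\gamma\in\mathbb{R}^{L\times L}_{\rm sym} : 0\preceq\gamma\preceq I_L,\ \mathrm{Tr}(\gamma)=N\}$. $\mathrm{Gr}(n,\mathbb{R}^L)$ denotes the set of rank-$n$ orthogonal projectors in $\mathbb{R}^{L\times L}_{\rm sym}$, and $\|\cdot\|$ is the Frobenius norm. Full disentanglement is said to be achieved (for $\gamma$, $\mathcal H_{\rm frag}$ and bath dimension $m$) if $$\min\{\|\Pi\gamma(I_L-\Pi)\|^2 : \Pi\in\mathrm{Gr}(\ell+m,\mathbb{R}^L),\ \Pi\,\Pi_{\rm frag}=\Pi_{\rm frag}\}=0,$$ equivalently if there is an $(\ell+m)$-dimensional $\gamma$-invariant subspace of $\mathbb{R}^L$ containing $\mathcal H_{\rm frag}$. *)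

theory Defs
  imports "HOL-Analysis.Analysis"
begin

text \<open>
  The space of column vectors with \<open>L\<close> real entries is \<open>real ^ 'n\<close> with \<open>CARD('n) = L\<close>. The
  index type carries no order, so the numbering \<open>e\<^sub>1, \<dots>, e\<^sub>L\<close> of the canonical basis is given by a
  bijection \<open>idx\<close> from \<open>{1..L}\<close> to \<open>'n\<close>.
\<close>

definition canonical_basis :: "(nat \<Rightarrow> 'n) \<Rightarrow> nat \<Rightarrow> real ^ 'n::finite"
  where "canonical_basis idx i = axis (idx i) 1"

definition frag_space :: "(nat \<Rightarrow> 'n) \<Rightarrow> nat \<Rightarrow> (real ^ 'n::finite) set"
  where "frag_space idx l = span (canonical_basis idx ` {1..l})"

definition symmetric_matrix :: "real ^ 'n ^ 'n::finite \<Rightarrow> bool"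
  where "symmetric_matrix A \<longleftrightarrow> transpose A = A"

definition positive_semidefinite :: "real ^ 'n ^ 'n::finite \<Rightarrow> bool"
  where "positive_semidefinite A \<longleftrightarrow> symmetric_matrix A \<and> (\<forall>x. 0 \<le> x \<bullet> (A *v x))"

definition loewner_le :: "real ^ 'n ^ 'n::finite \<Rightarrow> real ^ 'n ^ 'n \<Rightarrow> bool"  (infix \<open>\<preceq>\<close> 50)
  where "A \<preceq> B \<longleftrightarrow> positive_semidefinite (B - A)"

definition Gamma_MS :: "nat \<Rightarrow> (real ^ 'n ^ 'n::finite) set"
  where "Gamma_MS N = {\<gamma>. symmetric_matrix \<gamma> \<and> 0 \<preceq> \<gamma> \<and> \<gamma> \<preceq> mat 1 \<and> trace \<gamma> = real N}"

definition orthogonal_projector :: "real ^ 'n ^ 'n::finite \<Rightarrow> bool"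
  where "orthogonal_projector P \<longleftrightarrow> symmetric_matrix P \<and> P ** P = P"

definition Grassmannian :: "nat \<Rightarrow> (real ^ 'n ^ 'n::finite) set"
  where "Grassmannian k = {P. orthogonal_projector P \<and> rank P = k}"

definition projector_onto :: "(real ^ 'n) set \<Rightarrow> real ^ 'n ^ 'n::finite"
  where "projector_onto S = (THE P. orthogonal_projector P \<and> range ((*v) P) = S)"

text \<open>The description in \<open>projector_onto\<close> is proper for every subspace.\<close>

lemma projector_onto_ex1:
  fixes S :: "(real ^ 'n::finite) set"
  assumes "subspace S"
  shows "\<exists>!P. orthogonal_projector P \<and> range ((*v) P) = S"
proof -
  obtain B where B: "B \<subseteq> S" "pairwise orthogonal B" "\<And>x. x \<in> B \<Longrightarrow> norm x = 1"
      "independent B" "span B = S"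
    using orthonormal_basis_subspace[OF assms] by metis
  have finB: "finite B" using B(4) independent_imp_finite by blast
  have inn: "b \<bullet> c = (if b = c then 1 else 0)" if "b \<in> B" "c \<in> B" for b c
    using that B(2,3) by (auto simp: pairwise_def orthogonal_def norm_eq_1)
  define P :: "real ^ 'n ^ 'n" where "P = (\<chi> i j. \<Sum>b\<in>B. b $ i * b $ j)"
  have Px: "P *v x = (\<Sum>b\<in>B. (b \<bullet> x) *\<^sub>R b)" for x
    by (simp add: P_def vec_eq_iff matrix_vector_mult_def inner_vec_def sum_distrib_left
        sum_distrib_right mult_ac sum.swap[of _ B UNIV])
  have symP: "symmetric_matrix P"
    by (simp add: symmetric_matrix_def P_def transpose_def vec_eq_iff mult.commute)
  have PB: "P *v c = c" if "c \<in> B" for c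
    using that finB by (simp add: Px inn if_distrib[of "\<lambda>t. t *\<^sub>R _"] sum.delta cong: if_cong sum.cong)
  have PS: "P *v x = x" if "x \<in> S" for x
    using that unfolding B(5)[symmetric]
    by (induction rule: span_induct)
      (auto simp: PB subspace_def matrix_vector_right_distrib matrix_vector_mult_scaleR)
  have inS: "P *v x \<in> S" for x
    using B(1) assms by (auto simp: Px intro!: subspace_sum subspace_scale)
  have ran: "range ((*v) P) = S"
    using inS PS by (metis (no_types, lifting) image_subset_iff rangeI subsetI subset_antisym)
  have idem: "P ** P = P"
    by (simp add: matrix_eq matrix_vector_mul_assoc[symmetric] PS inS)
  have uniq: "Q = P" if Q: "orthogonal_projector Q" "range ((*v) Q) = S" for Q
  proof -
    have "Q *v (P *v x) = P *v x" for x
      using inS[of x] Q unfolding orthogonal_projector_def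
      by (metis imageE matrix_vector_mul_assoc)
    then have QP: "Q ** P = P" by (simp add: matrix_eq matrix_vector_mul_assoc[symmetric])
    have "P *v (Q *v x) = Q *v x" for x using PS Q(2) by blast
    then have PQ: "P ** Q = Q" by (simp add: matrix_eq matrix_vector_mul_assoc[symmetric])
    show ?thesis
      using QP PQ symP Q(1) unfolding orthogonal_projector_def symmetric_matrix_def
      by (metis matrix_transpose_mul)
  qed
  show ?thesis
    using symP idem ran uniq unfolding orthogonal_projector_def by blast
qed

definition is_minimum :: "real set \<Rightarrow> real \<Rightarrow> bool"
  where "is_minimum S v \<longleftrightarrow> v \<in> S \<and> (\<forall>x\<in>S. v \<le> x)"

text \<open>On \<open>real ^ 'n ^ 'n\<close> the function \<open>norm\<close> is the Frobenius norm.\<close>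

definition full_disentanglement :: "(nat \<Rightarrow> 'n) \<Rightarrow> nat \<Rightarrow> nat \<Rightarrow> real ^ 'n ^ 'n::finite \<Rightarrow> bool"
  where "full_disentanglement idx l m \<gamma> \<longleftrightarrow>
    is_minimum
      {(norm (Q ** \<gamma> ** (mat 1 - Q)))\<^sup>2 | Q.
        Q \<in> Grassmannian (l + m) \<and>
        Q ** projector_onto (frag_space idx l) = projector_onto (frag_space idx l)}
      0"

text \<open>Only the values of \<open>n\<close> and \<open>P\<close> on \<open>{1..s}\<close> matter; the rank \<open>m\<^sub>i\<close> of \<open>P\<^sub>i\<close> is \<open>rank (P i)\<close>.\<close>

definition spectral_decomposition ::
    "nat \<Rightarrow> real ^ 'n ^ 'n::finite \<Rightarrow> nat \<Rightarrow> (nat \<Rightarrow> real) \<Rightarrow> (nat \<Rightarrow> real ^ 'n ^ 'n) \<Rightarrow> bool"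
  where "spectral_decomposition N \<gamma> s n P \<longleftrightarrow>
    \<gamma> = (\<Sum>i = 1..s. n i *\<^sub>R P i) \<and>
    1 \<le> s \<and> s \<le> CARD('n) \<and>
    (\<forall>i\<in>{1..s}. 0 < n i \<and> n i \<le> 1) \<and>
    strict_mono_on {1..s} n \<and>
    (\<Sum>i = 1..s. n i * real (rank (P i))) = real N \<and>
    (\<forall>i\<in>{1..s}. orthogonal_projector (P i) \<and> 1 \<le> rank (P i)) \<and>
    (\<forall>i\<in>{1..s}. \<forall>j\<in>{1..s}. P i ** P j = (if i = j then P i else 0))"

definition direct_family :: "nat \<Rightarrow> (nat \<Rightarrow> (real ^ 'n::finite) set) \<Rightarrow> bool"
  where "direct_family s V \<longleftrightarrow>
    (\<forall>v. (\<forall>i\<in>{1..s}. v i \<in> V i) \<and> (\<Sum>i = 1..s. v i) = 0 \<longrightarrow> (\<forall>i\<in>{1..s}. v i = 0))"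

text \<open>Here \<open>+\<close> and \<open>\<Sum>\<close> are the elementwise (Minkowski) sums of sets.\<close>

definition X_space ::
    "(real ^ 'n) set \<Rightarrow> nat \<Rightarrow> (nat \<Rightarrow> real ^ 'n ^ 'n) \<Rightarrow> (real ^ 'n::finite) set"
  where "X_space H s P = H + (\<Sum>i = 1..s. (*v) (P i) ` H)"

definition invariant_subspace :: "real ^ 'n ^ 'n::finite \<Rightarrow> (real ^ 'n) set \<Rightarrow> bool"
  where "invariant_subspace A V \<longleftrightarrow> subspace V \<and> (*v) A ` V \<subseteq> V"

definition smallest_invariant_subspace ::
    "real ^ 'n ^ 'n::finite \<Rightarrow> (real ^ 'n) set \<Rightarrow> (real ^ 'n) set \<Rightarrow> bool"
  where "smallest_invariant_subspace A S V \<longleftrightarrow>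
    invariant_subspace A V \<and> S \<subseteq> V \<and> (\<forall>W. invariant_subspace A W \<and> S \<subseteq> W \<longrightarrow> V \<subseteq> W)"

end

theory Submission
  imports Defs
begin

text \<open>
  The spectral projectors are the orthogonal projectors onto the eigenspaces of the nonzero
  eigenvalues; the spectral theorem is obtained by maximising the Rayleigh quotient on the
  orthogonal complement of an invariant subspace. If \<open>W\<close> is invariant and contains \<open>H\<close>, then for
  \<open>h \<in> H\<close> the vector \<open>\<gamma> h = \<Sum> n\<^sub>i P\<^sub>i h\<close> is a sum in \<open>W\<close> of eigenvectors with distinct eigenvalues, so
  each \<open>P\<^sub>i h\<close> is in \<open>W\<close>; hence \<open>X\<close> is minimal. A projector \<open>Q\<close> has \<open>Q \<gamma> (1 - Q) = 0\<close> exactly when its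
  range is invariant, and any invariant subspace can be enlarged one dimension at a time by
  eigenvectors orthogonal to it, so all dimensions from \<open>dim X\<close> to \<open>L\<close> occur.
\<close>

section \<open>Symmetric matrices and invariant subspaces\<close>

lemma symmetric_matrix_inner:
  assumes "symmetric_matrix A"
  shows "x \<bullet> (A *v y) = (A *v x) \<bullet> y"
  using assms by (metis dot_lmul_matrix symmetric_matrix_def transpose_matrix_vector)

text \<open>For \<open>x\<close> in \<open>V\<close> and \<open>y\<close> orthogonal to
  \<open>V\<close>, symmetry moves \<open>A\<close> from \<open>y\<close> onto \<open>x\<close>, and
  \<open>A *v x\<close> is again in \<open>V\<close>.\<close>

lemma invariant_subspace_orthogonal_complement:
  assumes "symmetric_matrix A" and "invariant_subspace A V"
  shows "invariant_subspace A {y. \<forall>x\<in>V. x \<bullet> y = 0}"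
  using assms
  by (auto simp: invariant_subspace_def subspace_def inner_right_distrib symmetric_matrix_inner
      image_subset_iff)

text \<open>Compactness gives a maximiser \<open>x\<close> of the Rayleigh quotient on the unit
  sphere of \<open>V\<close>. The form \<open>g\<close> is then nonnegative on \<open>V\<close> and
  zero at \<open>x\<close>. Its derivative at \<open>x\<close> along the residual \<open>w\<close>
  is \<open>-2 * (w \<bullet> w)\<close>, which must not be negative; hence
  \<open>w = 0\<close>.\<close>

lemma symmetric_matrix_eigenvector:
  fixes A :: "real ^ 'n ^ 'n::finite"
  assumes sym: "symmetric_matrix A" and inv: "invariant_subspace A V"
    and z: "z \<in> V" "z \<noteq> 0"
  obtains v \<mu> where "v \<in> V" "v \<noteq> 0" "A *v v = \<mu> *\<^sub>R v"
proof -
  have V: "subspace V" and AV: "\<And>y. y \<in> V \<Longrightarrow> A *v y \<in> V"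
    using inv by (auto simp: invariant_subspace_def)
  let ?S = "sphere 0 1 \<inter> V"
  have "compact ?S"
    using closed_subspace[OF V] by (simp add: compact_Int_closed)
  moreover have "(1 / norm z) *\<^sub>R z \<in> ?S"
    using z V by (simp add: subspace_scale)
  moreover have "continuous_on ?S (\<lambda>x. x \<bullet> (A *v x))"
    by (intro continuous_intros)
  ultimately obtain x where x: "x \<in> ?S"
    and max: "\<And>y. y \<in> ?S \<Longrightarrow> y \<bullet> (A *v y) \<le> x \<bullet> (A *v x)"
    using continuous_attains_sup[of ?S "\<lambda>x. x \<bullet> (A *v x)"] by blast
  define \<mu> where "\<mu> = x \<bullet> (A *v x)"
  define g where "g y = \<mu> * (y \<bullet> y) - y \<bullet> (A *v y)" for y
  \<comment> \<open>\<open>g\<close> is homogeneous of degree two, so maximality on the unit sphere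
    gives the sign on all of \<open>V\<close>.\<close>
  have g_nonneg: "0 \<le> g y" if "y \<in> V" for y
  proof (cases "y = 0")
    case False
    have "(1 / norm y) *\<^sub>R y \<in> ?S"
      using that False V by (simp add: subspace_scale)
    from max[OF this] False show ?thesis
      by (simp add: g_def \<mu>_def matrix_vector_mult_scaleR field_simps dot_square_norm
          power2_eq_square)
  qed (simp add: g_def)
  define w where "w = A *v x - \<mu> *\<^sub>R x"
  have xV: "x \<in> V" and xx: "x \<bullet> x = 1"
    using x by (auto simp: norm_eq_1)
  have wV: "w \<in> V"
    using xV V AV by (simp add: w_def subspace_diff subspace_scale)
  have g_line: "g (x + t *\<^sub>R w) = t\<^sup>2 * g w - 2 * t * (w \<bullet> w)" for t
  proof -
    have "w \<bullet> w = w \<bullet> (A *v x) - \<mu> * (w \<bullet> x)"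
      by (subst (2) w_def) (simp add: inner_diff_right)
    then have "w \<bullet> (A *v x) = w \<bullet> w + \<mu> * (w \<bullet> x)"
      by simp
    moreover from this have "x \<bullet> (A *v w) = w \<bullet> w + \<mu> * (w \<bullet> x)"
      by (metis symmetric_matrix_inner[OF sym] inner_commute)
    ultimately show ?thesis
      using xx
      by (simp add: g_def \<mu>_def[symmetric] matrix_vector_right_distrib matrix_vector_mult_scaleR
          inner_add_left inner_add_right inner_commute[of x w] power2_eq_square algebra_simps)
  qed
  have "w \<bullet> w = 0"
  proof (rule ccontr)
    assume "w \<bullet> w \<noteq> 0"
    then have c: "0 < w \<bullet> w" by (simp add: order_less_le)
    \<comment> \<open>A step small enough that the linear term of \<open>g_line\<close> dominates:
      \<open>t * g w\<close> stays below \<open>w \<bullet> w\<close>. The summand 1 keeps the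
      denominator positive when \<open>g w = 0\<close>.\<close>
    define t where "t = (w \<bullet> w) / (g w + 1)"
    have d: "0 \<le> g w" using g_nonneg wV .
    have t: "0 < t" using c d by (simp add: t_def)
    have "0 \<le> t\<^sup>2 * g w - 2 * t * (w \<bullet> w)"
      using g_nonneg[of "x + t *\<^sub>R w"] xV wV V by (simp add: g_line subspace_add subspace_scale)
    then have "0 \<le> t * (t * g w - 2 * (w \<bullet> w))"
      by (simp add: power2_eq_square algebra_simps)
    then have "2 * (w \<bullet> w) \<le> t * g w"
      using t by (simp add: zero_le_mult_iff)
    also have "\<dots> \<le> w \<bullet> w"
      using c d by (simp add: t_def field_simps)
    finally show False using c by simp
  qed
  then have "A *v x = \<mu> *\<^sub>R x" by (simp add: w_def)
  moreover have "x \<noteq> 0" using xx by auto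
  ultimately show thesis using that xV by blast
qed

text \<open>The orthogonal complement of a proper invariant subspace is nonzero and again invariant,
  so it contains an eigenvector.\<close>

lemma eigenvector_orthogonal_to_invariant_subspace:
  fixes A :: "real ^ 'n ^ 'n::finite"
  assumes "symmetric_matrix A" and inv: "invariant_subspace A V" and "V \<noteq> UNIV"
  obtains v \<mu> where "v \<noteq> 0" "A *v v = \<mu> *\<^sub>R v" "\<And>x. x \<in> V \<Longrightarrow> x \<bullet> v = 0"
proof -
  have V: "subspace V" using inv by (simp add: invariant_subspace_def)
  then have "dim V \<noteq> DIM(real ^ 'n)"
    using dim_eq_full[of V] assms(3) by (simp add: span_eq_iff[THEN iffD2])
  then have "dim V < DIM(real ^ 'n)"
    using dim_subset_UNIV[of V] by linarith
  then obtain z where "z \<noteq> 0" and z: "\<And>y. y \<in> span V \<Longrightarrow> orthogonal z y"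
    using orthogonal_to_subspace_exists by blast
  have "z \<in> {y. \<forall>x\<in>V. x \<bullet> y = 0}"
    using z by (auto simp: orthogonal_def span_base inner_commute)
  then obtain v \<mu> where "v \<in> {y. \<forall>x\<in>V. x \<bullet> y = 0}" "v \<noteq> 0" "A *v v = \<mu> *\<^sub>R v"
    by (rule symmetric_matrix_eigenvector
      [OF assms(1) invariant_subspace_orthogonal_complement[OF assms(1,2)] _ \<open>z \<noteq> 0\<close>])
  then show thesis by (intro that[of v \<mu>]) simp_all
qed

text \<open>The span of the eigenvectors is invariant. Were it proper, some eigenvector would be
  orthogonal to it and also lie in it, hence be orthogonal to itself.\<close>

lemma span_eigenvectors:
  fixes A :: "real ^ 'n ^ 'n::finite"
  assumes "symmetric_matrix A"
  shows "span {v. \<exists>\<mu>. A *v v = \<mu> *\<^sub>R v} = UNIV" (is "span ?E = _")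
proof (rule ccontr)
  assume not_full: "span ?E \<noteq> UNIV"
  have "A *v x \<in> span ?E" if "x \<in> span ?E" for x
    using that
  proof (induction rule: span_induct)
    case base
    show ?case
      by (auto simp: subspace_def matrix_vector_right_distrib matrix_vector_mult_scaleR
          span_add span_scale span_zero)
  next
    case (step x)
    then obtain \<mu> where "A *v x = \<mu> *\<^sub>R x" by blast
    then show ?case using step by (simp add: span_scale span_base)
  qed
  then have "invariant_subspace A (span ?E)"
    by (auto simp: invariant_subspace_def)
  then obtain v \<mu> where v: "v \<noteq> 0" "A *v v = \<mu> *\<^sub>R v" "\<And>x. x \<in> span ?E \<Longrightarrow> x \<bullet> v = 0"
    using eigenvector_orthogonal_to_invariant_subspace assms not_full by blast
  then have "v \<bullet> v = 0" by (blast intro: span_base)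
  with v(1) show False by simp
qed

text \<open>Adjoining an eigenvector orthogonal to an invariant subspace keeps it invariant and
  raises its dimension by exactly one, so no dimension is skipped.\<close>

lemma invariant_subspace_extend:
  fixes A :: "real ^ 'n ^ 'n::finite"
  assumes sym: "symmetric_matrix A" and V: "invariant_subspace A V"
    and k: "dim V \<le> k" "k \<le> CARD('n)"
  shows "\<exists>W. invariant_subspace A W \<and> V \<subseteq> W \<and> dim W = k"
  using k
proof (induction k rule: dec_induct)
  case base
  show ?case using V by blast
next
  case (step k)
  then obtain W where W: "invariant_subspace A W" "V \<subseteq> W" "dim W = k"
    by auto
  have sW: "subspace W" using W(1) by (simp add: invariant_subspace_def)
  have "W \<noteq> UNIV" using W(3) step.prems by auto
  then obtain v \<mu> where v: "v \<noteq> 0" "A *v v = \<mu> *\<^sub>R v" "\<And>x. x \<in> W \<Longrightarrow> x \<bullet> v = 0"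
    using eigenvector_orthogonal_to_invariant_subspace sym W(1) by blast
  have "v \<notin> span W"
    using v(1) v(3)[of v] sW by (auto simp: span_eq_iff[THEN iffD2])
  then have "dim (span (insert v W)) = Suc k"
    using W(3) by (simp add: dim_insert)
  moreover have "A *v x \<in> span (insert v W)" if "x \<in> span (insert v W)" for x
    using that
  proof (induction rule: span_induct)
    case base
    show ?case
      by (auto simp: subspace_def matrix_vector_right_distrib matrix_vector_mult_scaleR
          span_add span_scale span_zero)
  next
    case (step x)
    then show ?case
      using v(2) W(1) by (auto simp: invariant_subspace_def span_scale span_base image_subset_iff)
  qed
  ultimately show ?case
    using W(2) by (intro exI[of _ "span (insert v W)"])
      (auto simp: invariant_subspace_def span_base)
qed

text \<open>Subtracting \<open>\<mu> k\<close> times the sum from its image under \<open>A\<close>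
  removes \<open>v k\<close> and scales every other summand by a nonzero factor. Induction applies
  to this scaled family, which is why \<open>v\<close> is arbitrary in it; \<open>v k\<close> is
  then the sum minus the other summands.\<close>

lemma eigenvector_summands_in_invariant_subspace:
  assumes W: "invariant_subspace A W" and "finite J" and "inj_on \<mu> J"
    and "\<And>j. j \<in> J \<Longrightarrow> A *v v j = \<mu> j *\<^sub>R v j" and "(\<Sum>j\<in>J. v j) \<in> W"
  shows "\<forall>j\<in>J. v j \<in> W"
  using assms(2-)
proof (induction J arbitrary: v rule: finite_induct)
  case (insert k J)
  have sW: "subspace W" and AW: "\<And>y. y \<in> W \<Longrightarrow> A *v y \<in> W"
    using W unfolding invariant_subspace_def by blast+
  let ?w = "\<Sum>j\<in>insert k J. v j"
  have "A *v ?w = (\<Sum>j\<in>insert k J. \<mu> j *\<^sub>R v j)"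
    unfolding vec.sum using insert.prems(2) by (rule sum.cong[OF refl])
  then have "A *v ?w - \<mu> k *\<^sub>R ?w = (\<Sum>j\<in>insert k J. (\<mu> j - \<mu> k) *\<^sub>R v j)"
    by (simp only: scaleR_sum_right sum_subtractf scaleR_left_diff_distrib)
  also have "\<dots> = (\<Sum>j\<in>J. (\<mu> j - \<mu> k) *\<^sub>R v j)"
    using insert.hyps by simp
  finally have "(\<Sum>j\<in>J. (\<mu> j - \<mu> k) *\<^sub>R v j) \<in> W"
    using subspace_diff[OF sW AW subspace_scale[OF sW]] insert.prems(3) by metis
  then have J: "\<forall>j\<in>J. (\<mu> j - \<mu> k) *\<^sub>R v j \<in> W"
    using insert.prems(1,2) by (intro insert.IH) (auto simp: matrix_vector_mult_scaleR)
  have vJ: "v j \<in> W" if "j \<in> J" for j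
  proof -
    have "\<mu> j \<noteq> \<mu> k" using inj_onD[OF insert.prems(1), of j k] that insert.hyps(2) by auto
    then have "v j = inverse (\<mu> j - \<mu> k) *\<^sub>R ((\<mu> j - \<mu> k) *\<^sub>R v j)" by simp
    then show ?thesis using J that subspace_scale[OF sW] by metis
  qed
  moreover have "v k = ?w - (\<Sum>j\<in>J. v j)"
    using insert.hyps by simp
  ultimately have "v k \<in> W"
    using subspace_diff[OF sW insert.prems(3) subspace_sum[OF sW vJ]] by simp
  with vJ show ?case by simp
qed simp

section \<open>Orthogonal projectors\<close>

lemma projector_onto:
  fixes S :: "(real ^ 'n::finite) set"
  assumes "subspace S"
  shows orthogonal_projector_projector_onto: "orthogonal_projector (projector_onto S)"
    and range_projector_onto: "range ((*v) (projector_onto S)) = S"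
  using theI'[OF projector_onto_ex1[OF assms]] by (simp_all add: projector_onto_def)

lemma orthogonal_projector_apply:
  assumes "orthogonal_projector P"
  shows "x \<in> range ((*v) P) \<longleftrightarrow> P *v x = x"
proof
  assume "x \<in> range ((*v) P)"
  then show "P *v x = x"
    using assms by (auto simp: orthogonal_projector_def matrix_vector_mul_assoc)
qed (metis rangeI)

lemma orthogonal_projector_range_eq:
  fixes P Q :: "real ^ 'n ^ 'n::finite"
  assumes "orthogonal_projector P" "orthogonal_projector Q" "range ((*v) P) = range ((*v) Q)"
  shows "P = Q"
  using assms projector_onto_ex1[of "range ((*v) P)"]
  by (metis matrix_vector_mul_linear linear_subspace_image subspace_UNIV)

text \<open>Symmetry and idempotence turn the squared length of \<open>P *v y\<close> into the inner
  product of a vector of the range with \<open>y\<close>.\<close>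

lemma orthogonal_projector_eq_0:
  assumes "orthogonal_projector P" and "\<And>x. x \<in> range ((*v) P) \<Longrightarrow> x \<bullet> y = 0"
  shows "P *v y = 0"
proof -
  have "(P *v y) \<bullet> (P *v y) = (P *v (P *v y)) \<bullet> y"
    using assms(1) by (simp add: symmetric_matrix_inner orthogonal_projector_def)
  also have "\<dots> = 0" using assms(2) by blast
  finally show ?thesis by simp
qed

text \<open>With an orthonormal basis \<open>B\<close> of the range, \<open>P\<close> is the sum of
  the matrices \<open>b b^T\<close>, each of trace \<open>b \<bullet> b = 1\<close>. This turns the
  condition on the trace of \<open>\<gamma>\<close> into the weighted sum of the ranks.\<close>

lemma trace_orthogonal_projector:
  fixes P :: "real ^ 'n ^ 'n::finite"
  assumes P: "orthogonal_projector P"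
  shows "trace P = real (rank P)"
proof -
  let ?S = "range ((*v) P)"
  have S: "subspace ?S"
    by (simp add: linear_subspace_image)
  obtain B where B: "B \<subseteq> ?S" "pairwise orthogonal B" "\<And>x. x \<in> B \<Longrightarrow> norm x = 1"
      "independent B" "card B = dim ?S" "span B = ?S"
    using orthonormal_basis_subspace[OF S] by metis
  have finB: "finite B" using B(4) independent_imp_finite by blast
  have Px: "P *v x = (\<Sum>b\<in>B. (b \<bullet> x) *\<^sub>R b)" for x
  proof -
    \<comment> \<open>\<open>P\<close> is symmetric and fixes \<open>b\<close>, so the coefficients
      of \<open>P *v x\<close> in the basis are those of \<open>x\<close> itself.\<close>
    have "(b \<bullet> (P *v x)) = b \<bullet> x" if "b \<in> B" for b
    proof -
      have "P *v b = b" using that B(1) P orthogonal_projector_apply by blast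
      then show ?thesis
        using P symmetric_matrix_inner[of P b x] by (simp add: orthogonal_projector_def)
    qed
    moreover have "P *v x = (\<Sum>b\<in>B. (b \<bullet> (P *v x)) *\<^sub>R b)"
      using B(2,3) orthonormal_basis_expand[of B "P *v x"] B(6) finB
      by (auto simp: inner_commute)
    ultimately show ?thesis by simp
  qed
  have "P $ i $ i = (\<Sum>b\<in>B. b $ i * b $ i)" for i
  proof -
    have "P $ i $ i = (P *v axis i 1) $ i"
      by (simp add: matrix_vector_mul_component inner_axis)
    also have "\<dots> = (\<Sum>b\<in>B. b $ i * b $ i)"
      by (simp add: Px inner_axis)
    finally show ?thesis .
  qed
  then have "trace P = (\<Sum>b\<in>B. b \<bullet> b)"
    by (simp add: trace_def inner_vec_def sum.swap[of _ B UNIV])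
  also have "\<dots> = real (card B)"
    using B(3) by (simp add: norm_eq_1)
  finally show ?thesis
    by (simp add: B(5) rank_dim_range)
qed

section \<open>Disentanglement as existence of an invariant subspace\<close>

text \<open>The vanishing block means \<open>Q ** A = Q ** A ** Q\<close>. Its transpose says that
  \<open>Q\<close> fixes every \<open>A *v (Q *v x)\<close>, that is, \<open>A\<close> maps the
  range of \<open>Q\<close> into itself.\<close>

lemma projector_offdiagonal_eq_0_iff:
  fixes A Q :: "real ^ 'n ^ 'n::finite"
  assumes A: "symmetric_matrix A" and Q: "orthogonal_projector Q"
  shows "Q ** A ** (mat 1 - Q) = 0 \<longleftrightarrow> invariant_subspace A (range ((*v) Q))"
proof -
  have tA: "transpose A = A" and tQ: "transpose Q = Q"
    using A Q by (simp_all add: symmetric_matrix_def orthogonal_projector_def)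
  have "Q ** A ** (mat 1 - Q) = 0 \<longleftrightarrow> Q ** A = Q ** A ** Q"
    by (auto simp: matrix_eq matrix_vector_mul_assoc[symmetric]
        matrix_vector_mult_diff_rdistrib matrix_vector_mult_diff_distrib)
  also have "\<dots> \<longleftrightarrow> A ** Q = Q ** (A ** Q)"
    by (metis matrix_transpose_mul transpose_transpose tA tQ matrix_mul_assoc)
  also have "\<dots> \<longleftrightarrow> (\<forall>x. Q *v (A *v (Q *v x)) = A *v (Q *v x))"
    by (auto simp: matrix_eq matrix_vector_mul_assoc[symmetric])
  also have "\<dots> \<longleftrightarrow> invariant_subspace A (range ((*v) Q))"
    by (auto simp: invariant_subspace_def orthogonal_projector_apply[OF Q] linear_subspace_image
        image_subset_iff)
  finally show ?thesis .
qed

lemma projector_mult_projector_onto_iff: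
  fixes Q :: "real ^ 'n ^ 'n::finite"
  assumes Q: "orthogonal_projector Q" and S: "subspace S"
  shows "Q ** projector_onto S = projector_onto S \<longleftrightarrow> S \<subseteq> range ((*v) Q)"
proof -
  have "Q ** projector_onto S = projector_onto S
      \<longleftrightarrow> (\<forall>y\<in>range ((*v) (projector_onto S)). Q *v y = y)"
    by (auto simp: matrix_eq matrix_vector_mul_assoc[symmetric])
  also have "\<dots> \<longleftrightarrow> S \<subseteq> range ((*v) Q)"
    using orthogonal_projector_apply[OF Q] range_projector_onto[OF S] by blast
  finally show ?thesis .
qed

text \<open>The objective is a squared norm, so 0 is its minimum as soon as it is attained. The
  admissible \<open>Q\<close> with value 0 are matched with the subspaces \<open>V\<close> by taking
  ranges in one direction and \<open>projector_onto\<close> in the other.\<close>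

lemma full_disentanglement_iff:
  assumes A: "symmetric_matrix A"
  shows "full_disentanglement idx l m A \<longleftrightarrow>
    (\<exists>V. invariant_subspace A V \<and> frag_space idx l \<subseteq> V \<and> dim V = l + m)"
    (is "_ \<longleftrightarrow> ?R")
proof -
  let ?H = "frag_space idx l"
  have H: "subspace ?H" by (simp add: frag_space_def)
  have "full_disentanglement idx l m A \<longleftrightarrow>
    (\<exists>Q. orthogonal_projector Q \<and> rank Q = l + m \<and> Q ** projector_onto ?H = projector_onto ?H \<and>
      Q ** A ** (mat 1 - Q) = 0)"
    by (auto simp: full_disentanglement_def is_minimum_def Grassmannian_def)
  also have "\<dots> \<longleftrightarrow> (\<exists>Q. orthogonal_projector Q \<and> dim (range ((*v) Q)) = l + m \<and>
      ?H \<subseteq> range ((*v) Q) \<and> invariant_subspace A (range ((*v) Q)))"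
    using projector_offdiagonal_eq_0_iff[OF A] projector_mult_projector_onto_iff[OF _ H]
    by (auto simp: rank_dim_range)
  also have "\<dots> \<longleftrightarrow> ?R"
  proof
    assume ?R
    then obtain V where V: "invariant_subspace A V" "?H \<subseteq> V" "dim V = l + m" by blast
    then have "subspace V" by (simp add: invariant_subspace_def)
    from projector_onto[OF this] V show "\<exists>Q. orthogonal_projector Q \<and>
        dim (range ((*v) Q)) = l + m \<and> ?H \<subseteq> range ((*v) Q) \<and>
        invariant_subspace A (range ((*v) Q))"
      by (intro exI[of _ "projector_onto V"]) simp
  qed blast
  finally show ?thesis .
qed

section \<open>The spectral decomposition\<close>

definition eigenspace :: "real ^ 'n ^ 'n::finite \<Rightarrow> real \<Rightarrow> (real ^ 'n) set"
  where "eigenspace A \<mu> = {v. A *v v = \<mu> *\<^sub>R v}"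

lemma subspace_eigenspace: "subspace (eigenspace A \<mu>)"
  by (auto simp: eigenspace_def subspace_def matrix_vector_right_distrib
      matrix_vector_mult_scaleR scaleR_right_distrib)

lemma eigenspace_orthogonal:
  assumes "symmetric_matrix A" "\<mu> \<noteq> \<nu>" "v \<in> eigenspace A \<mu>" "w \<in> eigenspace A \<nu>"
  shows "v \<bullet> w = 0"
  using symmetric_matrix_inner[OF assms(1), of v w] assms(2-) by (simp add: eigenspace_def)

text \<open>Zero is left out because the coefficients of the decomposition are positive: the kernel
  contributes no projector.\<close>

definition nonzero_eigenvalues :: "real ^ 'n ^ 'n::finite \<Rightarrow> real set"
  where "nonzero_eigenvalues A = {\<mu>. \<mu> \<noteq> 0 \<and> (\<exists>v. v \<noteq> 0 \<and> A *v v = \<mu> *\<^sub>R v)}"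

text \<open>One nonzero eigenvector per eigenvalue gives a pairwise orthogonal, hence independent,
  family indexed injectively.\<close>

lemma finite_card_nonzero_eigenvalues:
  fixes A :: "real ^ 'n ^ 'n::finite"
  assumes "symmetric_matrix A"
  shows finite_nonzero_eigenvalues: "finite (nonzero_eigenvalues A)"
    and card_nonzero_eigenvalues: "card (nonzero_eigenvalues A) \<le> CARD('n)"
proof -
  let ?E = "nonzero_eigenvalues A"
  have "\<exists>v. v \<noteq> 0 \<and> v \<in> eigenspace A \<mu>" if "\<mu> \<in> ?E" for \<mu>
    using that by (auto simp: nonzero_eigenvalues_def eigenspace_def)
  then obtain v where v: "\<And>\<mu>. \<mu> \<in> ?E \<Longrightarrow> v \<mu> \<noteq> 0 \<and> v \<mu> \<in> eigenspace A \<mu>" by metis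
  have orth: "v \<mu> \<bullet> v \<nu> = 0" if "\<mu> \<in> ?E" "\<nu> \<in> ?E" "\<mu> \<noteq> \<nu>" for \<mu> \<nu>
    using eigenspace_orthogonal assms v that by blast
  then have inj: "inj_on v ?E"
    by (metis (no_types, lifting) inj_onI inner_eq_zero_iff v)
  have "pairwise orthogonal (v ` ?E)"
    using orth by (auto simp: pairwise_def orthogonal_def)
  moreover have "0 \<notin> v ` ?E" using v by force
  ultimately have ind: "independent (v ` ?E)"
    by (rule pairwise_orthogonal_independent)
  then show "finite ?E"
    using inj independent_imp_finite finite_imageD by blast
  show "card ?E \<le> CARD('n)"
    using independent_bound[OF ind] inj by (simp add: card_image)
qed

lemma eigenspace_projector_apply:
  assumes A: "symmetric_matrix A" and v: "v \<in> eigenspace A \<mu>"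
  shows "projector_onto (eigenspace A \<nu>) *v v = (if \<mu> = \<nu> then v else 0)"
proof -
  note P = projector_onto[OF subspace_eigenspace[of A \<nu>]]
  show ?thesis
  proof (cases "\<mu> = \<nu>")
    case True
    then show ?thesis
      using v P orthogonal_projector_apply by (metis (full_types))
  next
    case False
    then show ?thesis
      using orthogonal_projector_eq_0[OF P(1), of v] P(2) eigenspace_orthogonal[OF A _ _ v]
      by (metis (full_types))
  qed
qed

text \<open>Both sides are linear and eigenvectors span the space, so it suffices to compare them on
  a single eigenvector, where at most one projector acts nontrivially.\<close>

lemma symmetric_matrix_eq_sum_projectors:
  fixes A :: "real ^ 'n ^ 'n::finite"
  assumes A: "symmetric_matrix A"
  shows "A = (\<Sum>\<mu>\<in>nonzero_eigenvalues A. \<mu> *\<^sub>R projector_onto (eigenspace A \<mu>))" (is "A = ?B")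
proof -
  have fin: "finite (nonzero_eigenvalues A)" using finite_nonzero_eigenvalues A .
  have B: "?B *v x = (\<Sum>\<mu>\<in>nonzero_eigenvalues A. \<mu> *\<^sub>R (projector_onto (eigenspace A \<mu>) *v x))" for x
    using fin
    by (induction rule: finite_induct)
      (simp_all add: matrix_vector_mult_add_rdistrib scaleR_matrix_vector_assoc[symmetric])
  have "A *v x = ?B *v x" if "x \<in> span {v. \<exists>\<mu>. A *v v = \<mu> *\<^sub>R v}" for x
    using that
  proof (induction rule: span_induct)
    case base
    show ?case
      by (auto simp: subspace_def matrix_vector_right_distrib matrix_vector_mult_scaleR)
  next
    case (step x)
    then obtain \<mu> where \<mu>: "x \<in> eigenspace A \<mu>" by (auto simp: eigenspace_def)
    have "?B *v x = (\<Sum>\<nu>\<in>nonzero_eigenvalues A. if \<mu> = \<nu> then \<nu> *\<^sub>R x else 0)"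
      unfolding B by (intro sum.cong refl) (simp add: eigenspace_projector_apply[OF A \<mu>])
    \<comment> \<open>If \<open>\<mu>\<close> is not among the indices, then
      \<open>\<mu> = 0\<close> or \<open>x = 0\<close>, and both sides vanish.\<close>
    also have "\<dots> = \<mu> *\<^sub>R x"
      using fin \<mu> by (auto simp: nonzero_eigenvalues_def eigenspace_def)
    finally show ?case using \<mu> by (simp add: eigenspace_def)
  qed
  then show ?thesis
    by (simp add: span_eigenvectors[OF A] matrix_eq)
qed

section \<open>Existence of the decomposition\<close>

lemma Gamma_MS_eigenvalue:
  assumes "\<gamma> \<in> Gamma_MS N" and "\<mu> \<in> nonzero_eigenvalues \<gamma>"
  shows "0 < \<mu>" "\<mu> \<le> 1"
proof -
  obtain v where v: "v \<noteq> 0" "\<gamma> *v v = \<mu> *\<^sub>R v"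
    using assms(2) by (auto simp: nonzero_eigenvalues_def)
  have "0 \<le> v \<bullet> (\<gamma> *v v)" "0 \<le> v \<bullet> ((mat 1 - \<gamma>) *v v)"
    using assms(1) by (simp_all add: Gamma_MS_def loewner_le_def positive_semidefinite_def)
  then have "0 \<le> \<mu> * (v \<bullet> v)" "0 \<le> (1 - \<mu>) * (v \<bullet> v)"
    using v(2) by (simp_all add: matrix_vector_mult_diff_rdistrib inner_diff_right algebra_simps)
  moreover have "0 < v \<bullet> v" using v(1) by simp
  ultimately have "0 \<le> \<mu>" "\<mu> \<le> 1"
    by (simp_all add: zero_le_mult_iff)
  moreover have "\<mu> \<noteq> 0" using assms(2) by (simp add: nonzero_eigenvalues_def)
  ultimately show "0 < \<mu>" "\<mu> \<le> 1" by simp_all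
qed

lemma trace_sum:
  fixes A :: "'i \<Rightarrow> 'a::comm_semiring_1 ^ 'n ^ 'n::finite"
  shows "finite I \<Longrightarrow> trace (\<Sum>i\<in>I. A i) = (\<Sum>i\<in>I. trace (A i))"
  by (induction rule: finite_induct) (simp_all add: trace_add trace_0[unfolded mat_0])

lemma trace_scaleR: "trace (c *\<^sub>R A) = c * trace (A :: real ^ 'n ^ 'n::finite)"
  by (simp add: trace_def sum_distrib_left)

lemma finite_set_strict_mono_enumeration:
  fixes S :: "'a::linorder set"
  assumes "finite S"
  obtains n where "strict_mono_on {1..card S} n" "bij_betw n {1..card S} S"
proof -
  let ?xs = "sorted_list_of_set S"
  \<comment> \<open>List positions start at 0, the indices of the decomposition at 1.\<close>
  define n where "n i = ?xs ! (i - 1)" for i :: nat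
  have len: "length ?xs = card S" by simp
  have mono: "strict_mono_on {1..card S} n"
  proof (rule strict_mono_onI)
    fix i j assume "i \<in> {1..card S}" "j \<in> {1..card S}" "i < j"
    then show "n i < n j"
      unfolding n_def by (intro sorted_wrt_nth_less[OF strict_sorted_list_of_set]) auto
  qed
  have "n ` {1..card S} = S"
  proof -
    have "n ` {1..card S} = (!) ?xs ` {0..<card S}"
      unfolding n_def by (force simp: image_iff Bex_def)
    also have "\<dots> = set ?xs"
      using len by (metis list.set_map map_nth set_upt)
    finally show ?thesis using assms by simp
  qed
  then show thesis
    using that mono by (auto simp: bij_betw_def intro: strict_mono_on_imp_inj_on)
qed

text \<open>The two lists of values are strictly sorted with the same set of elements, so they
  coincide; comparing lengths gives \<open>s = t\<close>.\<close>

lemma strict_mono_on_image_eq: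
  fixes f g :: "nat \<Rightarrow> 'a::linorder"
  assumes f: "strict_mono_on {1..s} f" and g: "strict_mono_on {1..t} g"
    and eq: "f ` {1..s} = g ` {1..t}"
  shows "s = t" "\<forall>i\<in>{1..s}. f i = g i"
proof -
  have sorted: "sorted_wrt (<) (map h [1..<Suc r])" if "strict_mono_on {1..r} h"
    for h :: "nat \<Rightarrow> 'a" and r
    using that by (auto simp: sorted_wrt_iff_nth_less strict_mono_on_def simp del: upt_Suc)
  have "map f [1..<Suc s] = map g [1..<Suc t]"
    using sorted[OF f] sorted[OF g] eq
    by (intro strict_sorted_equal) (auto simp: atLeastLessThanSuc_atLeastAtMost simp del: upt_Suc)
  then have len: "s = t" and "map f [1..<Suc s] = map g [1..<Suc s]"
    by (auto simp del: upt_Suc dest: arg_cong[of _ _ length])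
  then show "s = t" "\<forall>i\<in>{1..s}. f i = g i"
    by (auto simp del: upt_Suc)
qed

lemma spectral_decomposition_exists:
  fixes \<gamma> :: "real ^ 'n ^ 'n::finite"
  assumes \<gamma>: "\<gamma> \<in> Gamma_MS N" and N: "1 \<le> N"
  shows "\<exists>s n P. spectral_decomposition N \<gamma> s n P"
proof -
  let ?E = "nonzero_eigenvalues \<gamma>"
  have sym: "symmetric_matrix \<gamma>" and tr: "trace \<gamma> = real N"
    using \<gamma> by (simp_all add: Gamma_MS_def)
  have fin: "finite ?E" using finite_nonzero_eigenvalues sym .
  obtain n where n: "strict_mono_on {1..card ?E} n" "bij_betw n {1..card ?E} ?E"
    using finite_set_strict_mono_enumeration fin .
  define P where "P i = projector_onto (eigenspace \<gamma> (n i))" for i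
  have P: "orthogonal_projector (P i)" "range ((*v) (P i)) = eigenspace \<gamma> (n i)" for i
    by (simp_all add: P_def projector_onto subspace_eigenspace)
  have nE: "n i \<in> ?E" if "i \<in> {1..card ?E}" for i
    using n(2) that by (auto simp: bij_betw_def)
  have sum: "\<gamma> = (\<Sum>i = 1..card ?E. n i *\<^sub>R P i)"
    using symmetric_matrix_eq_sum_projectors[OF sym]
      sum.reindex_bij_betw[OF n(2), of "\<lambda>\<mu>. \<mu> *\<^sub>R projector_onto (eigenspace \<gamma> \<mu>)"]
    by (simp add: P_def)
  have trs: "(\<Sum>i = 1..card ?E. n i * real (rank (P i))) = real N"
    using arg_cong[OF sum, of trace] tr
    by (simp add: trace_sum trace_scaleR trace_orthogonal_projector[OF P(1)])
  \<comment> \<open>An empty sum has trace 0, whereas the trace is \<open>N\<close> and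
    \<open>1 \<le> N\<close>; this yields \<open>1 \<le> s\<close>.\<close>
  have "card ?E \<noteq> 0"
  proof
    assume "card ?E = 0"
    with trs N show False by simp
  qed
  have rank: "1 \<le> rank (P i)" if "i \<in> {1..card ?E}" for i
  proof -
    have "\<not> eigenspace \<gamma> (n i) \<subseteq> {0}"
      using nE[OF that] by (auto simp: nonzero_eigenvalues_def eigenspace_def)
    then show ?thesis
      by (simp add: rank_dim_range P(2) Suc_le_eq dim_eq_0 flip: neq0_conv)
  qed
  have orth: "P i ** P j = (if i = j then P i else 0)"
    if "i \<in> {1..card ?E}" "j \<in> {1..card ?E}" for i j
  proof -
    have "n j = n i \<longleftrightarrow> i = j"
      using inj_on_eq_iff[OF bij_betw_imp_inj_on[OF n(2)] that] by metis
    moreover have "P j *v x \<in> eigenspace \<gamma> (n j)" for x using P(2) by blast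
    ultimately have "P i *v (P j *v x) = (if i = j then P j *v x else 0)" for x
      unfolding P_def[of i] by (simp add: eigenspace_projector_apply[OF sym, of _ "n j"])
    then show ?thesis
      by (auto simp: matrix_eq matrix_vector_mul_assoc[symmetric])
  qed
  have "spectral_decomposition N \<gamma> (card ?E) n P"
    unfolding spectral_decomposition_def
  proof (intro conjI ballI)
    show "1 \<le> card ?E" using \<open>card ?E \<noteq> 0\<close> by simp
  qed (rule sum card_nonzero_eigenvalues[OF sym] Gamma_MS_eigenvalue[OF \<gamma> nE] n(1) trs P(1) rank
      orth; assumption)+
  then show ?thesis by blast
qed

section \<open>Uniqueness: coefficients and projectors are determined by the matrix\<close>

lemma spectral_decompositionD:
  assumes D: "spectral_decomposition N \<gamma> s n P"
  shows "inj_on n {1..s}"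
    and "i \<in> {1..s} \<Longrightarrow> n i \<noteq> 0"
    and "i \<in> {1..s} \<Longrightarrow> orthogonal_projector (P i)"
    and "i \<in> {1..s} \<Longrightarrow> rank (P i) \<noteq> 0"
proof -
  have mono: "strict_mono_on {1..s} n" and pos: "\<forall>i\<in>{1..s}. 0 < n i \<and> n i \<le> 1"
    and P: "\<forall>i\<in>{1..s}. orthogonal_projector (P i) \<and> 1 \<le> rank (P i)"
    using D unfolding spectral_decomposition_def by simp_all
  show "inj_on n {1..s}" by (rule strict_mono_on_imp_inj_on[OF mono])
  show "n i \<noteq> 0" if "i \<in> {1..s}" using pos that by fastforce
  show "orthogonal_projector (P i)" if "i \<in> {1..s}" using P that by simp
  show "rank (P i) \<noteq> 0" if "i \<in> {1..s}" using P that by fastforce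
qed

lemma spectral_decomposition_apply:
  assumes "spectral_decomposition N \<gamma> s n P"
  shows "\<gamma> *v x = (\<Sum>i = 1..s. n i *\<^sub>R (P i *v x))"
proof -
  have "(\<Sum>i\<in>I. n i *\<^sub>R P i) *v x = (\<Sum>i\<in>I. n i *\<^sub>R (P i *v x))" if "finite I" for I
    using that
    by (induction rule: finite_induct)
      (simp_all add: matrix_vector_mult_add_rdistrib scaleR_matrix_vector_assoc[symmetric])
  then show ?thesis
    using assms by (simp add: spectral_decomposition_def)
qed

lemma spectral_decomposition_projector_projector:
  assumes "spectral_decomposition N \<gamma> s n P" "i \<in> {1..s}" "j \<in> {1..s}"
  shows "P i *v (P j *v x) = (if i = j then P i *v x else 0)"
  using assms by (simp add: spectral_decomposition_def matrix_vector_mul_assoc)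

lemma spectral_decomposition_eigenvector:
  assumes D: "spectral_decomposition N \<gamma> s n P" and i: "i \<in> {1..s}"
  shows "\<gamma> *v (P i *v x) = n i *\<^sub>R (P i *v x)"
proof -
  have "\<gamma> *v (P i *v x) = (\<Sum>j = 1..s. if j = i then n i *\<^sub>R (P i *v x) else 0)"
    unfolding spectral_decomposition_apply[OF D] using i
    by (intro sum.cong refl) (simp add: spectral_decomposition_projector_projector[OF D])
  then show ?thesis using i by simp
qed

lemma spectral_decomposition_projector_mult:
  assumes D: "spectral_decomposition N \<gamma> s n P" and i: "i \<in> {1..s}"
  shows "P i *v (\<gamma> *v x) = n i *\<^sub>R (P i *v x)"
proof -
  have "P i *v (\<gamma> *v x) = (\<Sum>j = 1..s. if j = i then n i *\<^sub>R (P i *v x) else 0)"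
    unfolding spectral_decomposition_apply[OF D, of x] vec.sum using i
    by (intro sum.cong refl)
      (simp add: spectral_decomposition_projector_projector[OF D] matrix_vector_mult_scaleR)
  then show ?thesis using i by simp
qed

text \<open>For \<open>v\<close> in the eigenspace, evaluating \<open>P j *v (\<gamma> *v v)\<close>
  in two ways gives \<open>n i = n j\<close> or \<open>P j *v v = 0\<close>. Only the term with
  index \<open>i\<close> survives in \<open>\<gamma> *v v\<close>, and cancelling \<open>n i\<close>
  leaves \<open>v = P i *v v\<close>.\<close>

lemma spectral_decomposition_range:
  assumes D: "spectral_decomposition N \<gamma> s n P" and i: "i \<in> {1..s}"
  shows "range ((*v) (P i)) = eigenspace \<gamma> (n i)"
proof
  show "range ((*v) (P i)) \<subseteq> eigenspace \<gamma> (n i)"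
    using spectral_decomposition_eigenvector[OF D i] by (auto simp: eigenspace_def)
  show "eigenspace \<gamma> (n i) \<subseteq> range ((*v) (P i))"
  proof
    fix v assume "v \<in> eigenspace \<gamma> (n i)"
    then have v: "\<gamma> *v v = n i *\<^sub>R v" by (simp add: eigenspace_def)
    have ni: "n i \<noteq> 0" and inj: "inj_on n {1..s}"
      using spectral_decompositionD(1,2)[OF D] i by blast+
    have "P j *v v = 0" if "j \<in> {1..s}" "j \<noteq> i" for j
    proof -
      have "n i *\<^sub>R (P j *v v) = n j *\<^sub>R (P j *v v)"
        using spectral_decomposition_projector_mult[OF D that(1), of v] v
        by (simp add: matrix_vector_mult_scaleR)
      moreover have "n i \<noteq> n j" using inj_on_eq_iff[OF inj i that(1)] that(2) by simp
      ultimately show ?thesis by simp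
    qed
    then have "n i *\<^sub>R v = (\<Sum>j = 1..s. if j = i then n i *\<^sub>R (P i *v v) else 0)"
      unfolding v[symmetric] spectral_decomposition_apply[OF D] by (intro sum.cong refl) auto
    then have "n i *\<^sub>R v = n i *\<^sub>R (P i *v v)" using i by simp
    then have "v = P i *v v" using ni by simp
    then show "v \<in> range ((*v) (P i))" by blast
  qed
qed

text \<open>If \<open>\<gamma> *v v = \<mu> *\<^sub>R v\<close> is nonzero, some
  \<open>P i *v v\<close> is nonzero, and applying \<open>P i\<close> to the equation forces
  \<open>\<mu> = n i\<close>. Conversely each \<open>P i\<close> has nonzero rank, so its range
  supplies an eigenvector for \<open>n i\<close>.\<close>

lemma spectral_decomposition_eigenvalues:
  assumes D: "spectral_decomposition N \<gamma> s n P"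
  shows "n ` {1..s} = nonzero_eigenvalues \<gamma>"
proof
  show "n ` {1..s} \<subseteq> nonzero_eigenvalues \<gamma>"
  proof
    fix \<mu> assume "\<mu> \<in> n ` {1..s}"
    then obtain i where i: "i \<in> {1..s}" "\<mu> = n i" by blast
    have "dim (range ((*v) (P i))) \<noteq> 0" and "n i \<noteq> 0"
      using spectral_decompositionD(2,4)[OF D i(1)] by (simp_all add: rank_dim_range)
    then show "\<mu> \<in> nonzero_eigenvalues \<gamma>"
      unfolding spectral_decomposition_range[OF D i(1)]
      by (auto simp: nonzero_eigenvalues_def eigenspace_def i(2))
  qed
  show "nonzero_eigenvalues \<gamma> \<subseteq> n ` {1..s}"
  proof
    fix \<mu> assume "\<mu> \<in> nonzero_eigenvalues \<gamma>"
    then obtain v where v: "v \<noteq> 0" "\<gamma> *v v = \<mu> *\<^sub>R v" and \<mu>: "\<mu> \<noteq> 0"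
      by (auto simp: nonzero_eigenvalues_def)
    have "\<mu> *\<^sub>R v = (\<Sum>i = 1..s. n i *\<^sub>R (P i *v v))"
      unfolding v(2)[symmetric] by (rule spectral_decomposition_apply[OF D])
    then have "(\<Sum>i = 1..s. n i *\<^sub>R (P i *v v)) \<noteq> 0"
      using v(1) \<mu> by (metis scaleR_eq_0_iff)
    then obtain i where i: "i \<in> {1..s}" "n i *\<^sub>R (P i *v v) \<noteq> 0"
      by (rule sum.not_neutral_contains_not_neutral)
    have "\<mu> *\<^sub>R (P i *v v) = n i *\<^sub>R (P i *v v)"
      using spectral_decomposition_projector_mult[OF D i(1), of v] v(2)
      by (simp add: matrix_vector_mult_scaleR)
    then show "\<mu> \<in> n ` {1..s}" using i by auto
  qed
qed

text \<open>The coefficients are the nonzero eigenvalues in increasing order and the ranges are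
  their eigenspaces; an orthogonal projector is determined by its range.\<close>

lemma spectral_decomposition_unique:
  assumes D: "spectral_decomposition N \<gamma> s n P" and D': "spectral_decomposition N \<gamma> s' n' P'"
  shows "s = s' \<and> (\<forall>i\<in>{1..s}. n i = n' i \<and> P i = P' i)"
proof -
  have "strict_mono_on {1..s} n" "strict_mono_on {1..s'} n'" "n ` {1..s} = n' ` {1..s'}"
    using D D' spectral_decomposition_eigenvalues[OF D] spectral_decomposition_eigenvalues[OF D']
    by (simp_all add: spectral_decomposition_def)
  note n = strict_mono_on_image_eq[OF this]
  have "P i = P' i" if i: "i \<in> {1..s}" for i
  proof (rule orthogonal_projector_range_eq)
    have i': "i \<in> {1..s'}" using i n(1) by simp
    show "orthogonal_projector (P i)" "orthogonal_projector (P' i)"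
      using spectral_decompositionD(3) D i D' i' by blast+
    have "n i = n' i" using n(2) i by blast
    then show "range ((*v) (P i)) = range ((*v) (P' i))"
      by (simp only: spectral_decomposition_range[OF D i] spectral_decomposition_range[OF D' i'])
  qed
  with n show ?thesis by blast
qed

section \<open>The smallest invariant subspace\<close>

text \<open>Applying \<open>P i\<close> to a vanishing sum annihilates every summand except the one
  with index \<open>i\<close>.\<close>

lemma direct_family_projectors:
  assumes D: "spectral_decomposition N \<gamma> s n P"
  shows "direct_family s (\<lambda>i. (*v) (P i) ` H)"
  unfolding direct_family_def
proof (intro allI impI ballI)
  fix v i
  assume v: "(\<forall>i\<in>{1..s}. v i \<in> (*v) (P i) ` H) \<and> (\<Sum>i = 1..s. v i) = 0" and i: "i \<in> {1..s}"
  have "P i *v v j = (if j = i then v i else 0)" if j: "j \<in> {1..s}" for j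
  proof -
    obtain h where "v j = P j *v h" using v j by blast
    then show ?thesis using spectral_decomposition_projector_projector[OF D i j] by auto
  qed
  then have "(\<Sum>j = 1..s. P i *v v j) = v i"
    using i by simp
  moreover have "(\<Sum>j = 1..s. P i *v v j) = 0"
    using v by (simp add: vec.sum[symmetric])
  ultimately show "v i = 0" by simp
qed

text \<open>Replaces the Minkowski sums by explicit vectors. Each projector has its own argument
  \<open>k i\<close>, since the summands are chosen independently.\<close>

lemma X_spaceE:
  assumes "x \<in> X_space H s P"
  obtains h k where "h \<in> H" "\<And>i. i \<in> {1..s} \<Longrightarrow> k i \<in> H" "x = h + (\<Sum>i = 1..s. P i *v k i)"
proof -
  obtain h v where h: "h \<in> H" and v: "\<forall>i\<in>{1..s}. v i \<in> (*v) (P i) ` H"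
    and x: "x = h + (\<Sum>i = 1..s. v i)"
    using assms by (auto simp: X_space_def set_plus_def set_sum_alt)
  from v have "\<forall>i\<in>{1..s}. \<exists>y. y \<in> H \<and> v i = P i *v y"
    by blast
  from bchoice[OF this] obtain k where k: "\<forall>i\<in>{1..s}. k i \<in> H \<and> v i = P i *v k i"
    by blast
  show thesis
    using h k x by (intro that[of h k]) simp_all
qed

lemma X_spaceI:
  assumes "h \<in> H" "\<And>i. i \<in> {1..s} \<Longrightarrow> k i \<in> H"
  shows "h + (\<Sum>i = 1..s. P i *v k i) \<in> X_space H s P"
proof -
  have "(\<Sum>i = 1..s. P i *v k i) \<in> (\<Sum>i = 1..s. (*v) (P i) ` H)"
    using assms(2) by (auto simp: set_sum_alt)
  then show ?thesis
    unfolding X_space_def using assms(1) by (rule set_plus_intro[rotated])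
qed

lemma subspace_X_space:
  assumes H: "subspace H"
  shows "subspace (X_space H s P)"
proof (rule subspaceI)
  show "0 \<in> X_space H s P"
    using X_spaceI[where h = 0 and k = "\<lambda>_. 0" and H = H and s = s and P = P] subspace_0[OF H]
    by simp
next
  fix x y assume "x \<in> X_space H s P" "y \<in> X_space H s P"
  then obtain h k h' k' where
    hk: "h \<in> H" "\<And>i. i \<in> {1..s} \<Longrightarrow> k i \<in> H" "x = h + (\<Sum>i = 1..s. P i *v k i)" and
    hk': "h' \<in> H" "\<And>i. i \<in> {1..s} \<Longrightarrow> k' i \<in> H" "y = h' + (\<Sum>i = 1..s. P i *v k' i)"
    by (elim X_spaceE) (rule that)
  have "x + y = (h + h') + (\<Sum>i = 1..s. P i *v (k i + k' i))"
    unfolding hk(3) hk'(3) by (simp add: matrix_vector_right_distrib sum.distrib)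
  then show "x + y \<in> X_space H s P"
    using hk(1,2) hk'(1,2) by (simp only:) (intro X_spaceI subspace_add[OF H])
next
  fix c x assume "x \<in> X_space H s P"
  then obtain h k where
    hk: "h \<in> H" "\<And>i. i \<in> {1..s} \<Longrightarrow> k i \<in> H" "x = h + (\<Sum>i = 1..s. P i *v k i)"
    by (elim X_spaceE) (rule that)
  have "c *\<^sub>R x = c *\<^sub>R h + (\<Sum>i = 1..s. P i *v (c *\<^sub>R k i))"
    unfolding hk(3) by (simp add: matrix_vector_mult_scaleR scaleR_right_distrib scaleR_sum_right)
  then show "c *\<^sub>R x \<in> X_space H s P"
    using hk(1,2) by (simp only:) (intro X_spaceI subspace_scale[OF H])
qed

text \<open>\<open>\<gamma>\<close> acts on the range of \<open>P i\<close> as the scalar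
  \<open>n i\<close>, which gives invariance. For minimality, an invariant \<open>W\<close>
  containing \<open>H\<close> must contain every \<open>P i *v h\<close>, because these are the
  eigencomponents of \<open>\<gamma> *v h\<close> up to nonzero factors.\<close>

lemma smallest_invariant_subspace_X_space:
  assumes D: "spectral_decomposition N \<gamma> s n P" and H: "subspace H"
  shows "smallest_invariant_subspace \<gamma> H (X_space H s P)"
  unfolding smallest_invariant_subspace_def
proof (intro conjI allI impI)
  have "\<gamma> *v x \<in> X_space H s P" if x: "x \<in> X_space H s P" for x
  proof -
    obtain h k where
      hk: "h \<in> H" "\<And>i. i \<in> {1..s} \<Longrightarrow> k i \<in> H" "x = h + (\<Sum>i = 1..s. P i *v k i)"
      using x by (elim X_spaceE) (rule that)
    have "\<gamma> *v x = (\<Sum>i = 1..s. n i *\<^sub>R (P i *v h)) + (\<Sum>i = 1..s. n i *\<^sub>R (P i *v k i))"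
      unfolding hk(3) matrix_vector_right_distrib vec.sum
      by (simp add: spectral_decomposition_eigenvector[OF D] spectral_decomposition_apply[OF D, of h])
    \<comment> \<open>The image lies in the sum of the projected spaces alone: its component from
      \<open>H\<close> is 0, and the arguments \<open>n i *\<^sub>R (h + k i)\<close> stay in
      \<open>H\<close>.\<close>
    also have "\<dots> = 0 + (\<Sum>i = 1..s. P i *v (n i *\<^sub>R (h + k i)))"
      by (simp add: sum.distrib matrix_vector_right_distrib matrix_vector_mult_scaleR
          scaleR_right_distrib)
    also have "\<dots> \<in> X_space H s P"
      using hk(1,2) by (intro X_spaceI subspace_0[OF H] subspace_scale[OF H] subspace_add[OF H])
    finally show ?thesis .
  qed
  then show "invariant_subspace \<gamma> (X_space H s P)"
    using subspace_X_space[OF H] by (auto simp: invariant_subspace_def)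
  show "H \<subseteq> X_space H s P"
  proof
    fix h assume "h \<in> H"
    then have "h + (\<Sum>i = 1..s. P i *v 0) \<in> X_space H s P"
      by (intro X_spaceI subspace_0[OF H])
    then show "h \<in> X_space H s P" by simp
  qed
  fix W assume "invariant_subspace \<gamma> W \<and> H \<subseteq> W"
  then have inv: "invariant_subspace \<gamma> W" and HW: "H \<subseteq> W" by simp_all
  have W: "subspace W" using inv by (simp add: invariant_subspace_def)
  note n = spectral_decompositionD(1,2)[OF D]
  have PW: "P i *v h \<in> W" if h: "h \<in> H" and i: "i \<in> {1..s}" for h i
  proof -
    have "\<gamma> *v h \<in> W" using h HW inv by (auto simp: invariant_subspace_def)
    then have "\<forall>i\<in>{1..s}. n i *\<^sub>R (P i *v h) \<in> W"
      unfolding spectral_decomposition_apply[OF D]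
      by (intro eigenvector_summands_in_invariant_subspace[OF inv _ n(1)])
        (simp_all add: matrix_vector_mult_scaleR spectral_decomposition_eigenvector[OF D])
    then have "inverse (n i) *\<^sub>R (n i *\<^sub>R (P i *v h)) \<in> W"
      using i W by (blast intro: subspace_scale)
    then show ?thesis using n(2)[OF i] by simp
  qed
  show "X_space H s P \<subseteq> W"
  proof
    fix x assume "x \<in> X_space H s P"
    then obtain h k where
      hk: "h \<in> H" "\<And>i. i \<in> {1..s} \<Longrightarrow> k i \<in> H" "x = h + (\<Sum>i = 1..s. P i *v k i)"
      by (elim X_spaceE) (rule that)
    have "h \<in> W" using hk(1) HW by blast
    moreover have "(\<Sum>i = 1..s. P i *v k i) \<in> W"
      by (intro subspace_sum[OF W] PW hk(2))
    ultimately show "x \<in> W"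
      unfolding hk(3) by (rule subspace_add[OF W])
  qed
qed

text \<open>Uniqueness is asserted on \<open>{1..s}\<close>, outside of which \<open>n\<close> and
  \<open>P\<close> are arbitrary. \<open>direct_family\<close> expresses that the sum of the
  projected spaces is direct, and the casts to integers keep the subtractions from being
  truncated.\<close>

theorem proposition9:
  fixes L l m N M :: nat
    and idx :: "nat \<Rightarrow> 'n::finite"
    and \<gamma> :: "real ^ 'n ^ 'n"
  assumes "L = CARD('n)" and "bij_betw idx {1..L} (UNIV :: 'n set)"
    and "1 \<le> L" and "1 \<le> l" and "1 \<le> m" and "1 \<le> N"
    and "int M = int L - int l" and "int m \<le> int M - 1" and "N \<le> L"
    and "\<gamma> \<in> Gamma_MS N"
  shows "(\<exists>s n P. spectral_decomposition N \<gamma> s n P) \<and>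
    (\<forall>s n P s' n' P'.
      spectral_decomposition N \<gamma> s n P \<and> spectral_decomposition N \<gamma> s' n' P' \<longrightarrow>
      s = s' \<and> (\<forall>i\<in>{1..s}. n i = n' i \<and> P i = P' i)) \<and>
    (\<forall>s n P. spectral_decomposition N \<gamma> s n P \<longrightarrow>
      direct_family s (\<lambda>i. (*v) (P i) ` frag_space idx l) \<and>
      smallest_invariant_subspace \<gamma> (frag_space idx l) (X_space (frag_space idx l) s P) \<and>
      (full_disentanglement idx l m \<gamma> \<longleftrightarrow>
        int m \<ge> int (dim (X_space (frag_space idx l) s P)) - int l))"
proof (intro conjI allI impI)
  show "\<exists>s n P. spectral_decomposition N \<gamma> s n P"
    using spectral_decomposition_exists assms(6,10) by blast
next
  fix s n P s' n' P'
  assume "spectral_decomposition N \<gamma> s n P \<and> spectral_decomposition N \<gamma> s' n' P'"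
  then have D: "spectral_decomposition N \<gamma> s n P" "spectral_decomposition N \<gamma> s' n' P'"
    by simp_all
  from spectral_decomposition_unique[OF D]
  show "s = s'" "\<forall>i\<in>{1..s}. n i = n' i \<and> P i = P' i" by simp_all
next
  fix s n P
  assume D: "spectral_decomposition N \<gamma> s n P"
  let ?H = "frag_space idx l"
  let ?X = "X_space ?H s P"
  show "direct_family s (\<lambda>i. (*v) (P i) ` ?H)"
    using direct_family_projectors[OF D] .
  have H: "subspace ?H" by (simp add: frag_space_def)
  show smallest: "smallest_invariant_subspace \<gamma> ?H ?X"
    using smallest_invariant_subspace_X_space[OF D H] .
  have sym: "symmetric_matrix \<gamma>" using assms(10) by (simp add: Gamma_MS_def)
  have "full_disentanglement idx l m \<gamma> \<longleftrightarrow> dim ?X \<le> l + m"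
    unfolding full_disentanglement_iff[OF sym]
  proof
    assume "\<exists>V. invariant_subspace \<gamma> V \<and> ?H \<subseteq> V \<and> dim V = l + m"
    then obtain V where V: "invariant_subspace \<gamma> V" "?H \<subseteq> V" "dim V = l + m" by blast
    then have "?X \<subseteq> V" using smallest by (simp add: smallest_invariant_subspace_def)
    then show "dim ?X \<le> l + m" using dim_subset[of ?X V] V(3) by simp
  next
    assume "dim ?X \<le> l + m"
    \<comment> \<open>The bound on the bath dimension leaves room in the whole space to enlarge
      \<open>?X\<close> to dimension \<open>l + m\<close>.\<close>
    moreover have "l + m \<le> CARD('n)" using assms(1,7,8) by linarith
    moreover have X: "invariant_subspace \<gamma> ?X" "?H \<subseteq> ?X"
      using smallest by (simp_all add: smallest_invariant_subspace_def)
    ultimately obtain V where "invariant_subspace \<gamma> V" "?X \<subseteq> V" "dim V = l + m"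
      using invariant_subspace_extend[OF sym X(1)] by blast
    with X(2) show "\<exists>V. invariant_subspace \<gamma> V \<and> ?H \<subseteq> V \<and> dim V = l + m"
      by blast
  qed
  then show "full_disentanglement idx l m \<gamma> \<longleftrightarrow> int m \<ge> int (dim ?X) - int l"
    by linarith
qed

end
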